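(* Let $(X,d)$ be a metric space, let $f$ be an unbounded modulus function, let $(A_k)_{k\ge 1}\subset CL(X)$ and $A\in CL(X)$. (a) If $(A_k)_k$ is Wijsman $f$-strong Cesàro convergent to $A$, then $(A_k)_k$ is Wijsman $f$-statistically convergent to $A$ and $(A_k)_k$ is Wijsman uniformly integrable. (b) Assume that $f$ is compatible. If $(A_k)_k$ is Wijsman $f$-statistically convergent to $A$ and $(A_k)_k$ is Wijsman uniformly integrable, then $(A_k)_k$ is Wijsman $f$-strong Cesàro convergent to $A$.
   Context: $\mathbb{R}^+=[0,\infty)$. A modulus function is a function $f:\mathbb{R}^+\to\mathbb{R}^+$ such that: $f(x)=0$ if and only if $x=0$; $f(x+y)\le f(x)+f(y)$ for all $x,y\in\mathbb{R}^+$; $f$ is increasing ($x\le y$ implies $f(x)\le f(y)$); $f$ is continuous from the right at $0$. All modulus functions are assumed unbounded. $f$ is compatible if $\lim_{\varepsilon\to 0^+}\varphi(\varepsilon)=0$, where $\varphi(\varepsilon)=\limsup_{n\to\infty}\frac{f(n\varepsilon)}{f(n)}$ ($n\in\mathbb{N}$). $CL(X)$ is the family of all nonempty closed subsets of $X$, and $d(x,A)=\inf_{a\in A}d(x,a)$. $\#$ denotes cardinality. For a real sequence $(x_k)_{k\ge1}$ and $L\in\mathbb{R}$: it is $f$-statistically convergent to $L$ if for every $\varepsilon>0$, $\lim_{n\to\infty}\frac{1}{f(n)}f(\#\{k\le n: |x_k-L|>\varepsilon\})=0$; it is $f$-strong Cesàro convergent to $L$ if $\lim_{n\to\infty}\frac{f\left(\sum_{k=1}^n|x_k-L|\right)}{f(n)}=0$;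 it is uniformly integrable if $\lim_{c\to\infty}\sup_{n}\frac1n\sum_{1\le k\le n,\ |x_k|\ge c}|x_k|=0$. $(A_k)_k\subset CL(X)$ is Wijsman $f$-statistically convergent (resp. Wijsman $f$-strong Cesàro convergent) to $A\in CL(X)$ if for every $x\in X$ the real sequence $(d(x,A_k))_k$ is $f$-statistically convergent (resp. $f$-strong Cesàro convergent) to $d(x,A)$. $(A_k)_k\subset CL(X)$ is Wijsman uniformly integrable if for every $x\in X$ the real sequence $(d(x,A_k))_k$ is uniformly integrable. *)

theory Defs
  imports "HOL-Analysis.Analysis"
begin

text \<open>
  A function \<open>[0,\<infinity>) \<rightarrow> [0,\<infinity>)\<close> is represented by a total function on the reals of which
  only the values on \<open>{0..}\<close> are constrained or used. Sequences \<open>(x\<^sub>k)\<close> with \<open>k \<ge> 1\<close> are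
  functions on \<open>nat\<close> whose value at \<open>0\<close> is never used.
\<close>

definition modulus_function :: "(real \<Rightarrow> real) \<Rightarrow> bool" where
  "modulus_function f \<longleftrightarrow>
     (\<forall>x\<ge>0. f x \<ge> 0) \<and>
     (\<forall>x\<ge>0. f x = 0 \<longleftrightarrow> x = 0) \<and>
     (\<forall>x\<ge>0. \<forall>y\<ge>0. f (x + y) \<le> f x + f y) \<and>
     mono_on {0..} f \<and>
     continuous (at_right 0) f"

definition unbounded_modulus :: "(real \<Rightarrow> real) \<Rightarrow> bool" where
  "unbounded_modulus f \<longleftrightarrow> modulus_function f \<and> \<not> bounded (f ` {0..})"

text \<open>Upper limits and suprema are taken in \<open>ereal\<close>, so that they are never junk values.\<close>

definition compatible :: "(real \<Rightarrow> real) \<Rightarrow> bool" where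
  "compatible f \<longleftrightarrow>
     ((\<lambda>\<epsilon>. limsup (\<lambda>n. ereal (f (real n * \<epsilon>) / f (real n)))) \<longlongrightarrow> 0) (at_right 0)"

definition CL :: "'a::metric_space set set" where
  "CL = {A. closed A \<and> A \<noteq> {}}"

definition f_stat_convergent :: "(real \<Rightarrow> real) \<Rightarrow> (nat \<Rightarrow> real) \<Rightarrow> real \<Rightarrow> bool" where
  "f_stat_convergent f x L \<longleftrightarrow>
     (\<forall>\<epsilon>>0. (\<lambda>n. 1 / f (real n) * f (real (card {k \<in> {1..n}. \<bar>x k - L\<bar> > \<epsilon>}))) \<longlonglongrightarrow> 0)"

definition f_strong_Cesaro_convergent :: "(real \<Rightarrow> real) \<Rightarrow> (nat \<Rightarrow> real) \<Rightarrow> real \<Rightarrow> bool" where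
  "f_strong_Cesaro_convergent f x L \<longleftrightarrow>
     (\<lambda>n. f (\<Sum>k=1..n. \<bar>x k - L\<bar>) / f (real n)) \<longlonglongrightarrow> 0"

definition uniformly_integrable_seq :: "(nat \<Rightarrow> real) \<Rightarrow> bool" where
  "uniformly_integrable_seq x \<longleftrightarrow>
     ((\<lambda>c::real. SUP n\<in>{1..}. ereal (1 / real n * (\<Sum>k | k \<in> {1..n} \<and> \<bar>x k\<bar> \<ge> c. \<bar>x k\<bar>))) \<longlongrightarrow> 0) at_top"

definition Wijsman_f_stat_convergent ::
  "(real \<Rightarrow> real) \<Rightarrow> (nat \<Rightarrow> 'a::metric_space set) \<Rightarrow> 'a set \<Rightarrow> bool" where
  "Wijsman_f_stat_convergent f As A \<longleftrightarrow>
     (\<forall>x. f_stat_convergent f (\<lambda>k. infdist x (As k)) (infdist x A))"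

definition Wijsman_f_strong_Cesaro_convergent ::
  "(real \<Rightarrow> real) \<Rightarrow> (nat \<Rightarrow> 'a::metric_space set) \<Rightarrow> 'a set \<Rightarrow> bool" where
  "Wijsman_f_strong_Cesaro_convergent f As A \<longleftrightarrow>
     (\<forall>x. f_strong_Cesaro_convergent f (\<lambda>k. infdist x (As k)) (infdist x A))"

definition Wijsman_uniformly_integrable :: "(nat \<Rightarrow> 'a::metric_space set) \<Rightarrow> bool" where
  "Wijsman_uniformly_integrable As \<longleftrightarrow>
     (\<forall>x. uniformly_integrable_seq (\<lambda>k. infdist x (As k)))"

end

theory Submission
  imports Defs
begin

text \<open>
  Write \<open>S n\<close> for the partial sums of \<open>\<bar>x k - L\<bar>\<close>. Everything rests on \<open>f (m * x) \<le> m * f x\<close>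
  for natural \<open>m\<close>. Strong convergence forces \<open>S n / n \<longlonglongrightarrow> 0\<close>, since \<open>n \<le> m * S n\<close> would give
  \<open>f (S n) / f n \<ge> 1 / m\<close>; for \<open>c \<ge> 2 * \<bar>L\<bar>\<close> the terms with \<open>\<bar>x k\<bar> \<ge> c\<close> satisfy
  \<open>\<bar>x k\<bar> \<le> 2 * \<bar>x k - L\<bar>\<close>, whence uniform integrability. Conversely, uniform integrability
  gives \<open>S n \<le> 3 * \<epsilon> * n + M * #{k \<le> n. \<bar>x k - L\<bar> > \<epsilon>}\<close>, so \<open>f (S n) / f n\<close> is at
  most \<open>f (3 * \<epsilon> * n) / f n\<close>, which compatibility controls, plus a null sequence.
\<close>

lemma modulus_function_nonneg:
  assumes "modulus_function f" "x \<ge> 0"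
  shows "f x \<ge> 0"
  using assms by (simp add: modulus_function_def)

lemma modulus_function_pos:
  assumes "modulus_function f" "x > 0"
  shows "f x > 0"
  using assms unfolding modulus_function_def by (metis less_eq_real_def less_irrefl)

lemma modulus_function_zero: "modulus_function f \<Longrightarrow> f 0 = 0"
  by (simp add: modulus_function_def)

lemma modulus_function_mono:
  assumes "modulus_function f" "0 \<le> x" "x \<le> y"
  shows "f x \<le> f y"
  using assms unfolding modulus_function_def by (auto elim!: mono_onD)

lemma modulus_function_add:
  assumes "modulus_function f" "x \<ge> 0" "y \<ge> 0"
  shows "f (x + y) \<le> f x + f y"
  using assms by (simp add: modulus_function_def)

lemma modulus_function_mult:
  assumes f: "modulus_function f" and x: "x \<ge> 0"
  shows "f (real m * x) \<le> real m * f x"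
proof (induction m)
  case 0
  then show ?case using modulus_function_zero[OF f] by simp
next
  case (Suc m)
  have "f (real (Suc m) * x) = f (real m * x + x)"
    by (simp add: algebra_simps)
  also have "\<dots> \<le> f (real m * x) + f x"
    using f x by (intro modulus_function_add) auto
  finally show ?case using Suc by (simp add: algebra_simps)
qed

text \<open>Subadditivity controls only integer multiples, so the real constants met below are
  rounded up to a natural \<open>m\<close> before this is applied.\<close>

lemma modulus_function_le_mult:
  assumes f: "modulus_function f" and "0 \<le> y" "0 \<le> x" "y \<le> real m * x"
  shows "f y \<le> real m * f x"
  using modulus_function_mono[OF f \<open>0 \<le> y\<close> \<open>y \<le> real m * x\<close>] modulus_function_mult[OF f \<open>0 \<le> x\<close>, of m]
  by simp

text \<open>Removes \<open>ereal\<close> from the later arguments: a supremum is at most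
  \<open>e\<close> iff each of its terms is, and for a nonnegative function tending to 0 means being
  eventually at most each real \<open>e > 0\<close>.\<close>

lemma uniformly_integrable_seq_iff:
  "uniformly_integrable_seq x \<longleftrightarrow>
     (\<forall>e>0. \<exists>C. \<forall>c\<ge>C. \<forall>n\<ge>1. (\<Sum>k | k \<in> {1..n} \<and> \<bar>x k\<bar> \<ge> c. \<bar>x k\<bar>) \<le> e * real n)"
  (is "_ = (\<forall>e>0. \<exists>C. \<forall>c\<ge>C. \<forall>n\<ge>1. ?T c n \<le> _)")
proof -
  define G where "G c = (SUP n\<in>{1..}. ereal (1 / real n * ?T c n))" for c
  have G_le: "G c \<le> ereal e \<longleftrightarrow> (\<forall>n\<ge>1. ?T c n \<le> e * real n)" for c e
    unfolding G_def by (auto simp: SUP_le_iff field_simps)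
  have G_nonneg: "G c \<ge> 0" for c
    \<comment> \<open>The index 1 supplies a nonnegative term below the supremum.\<close>
    unfolding G_def by (rule SUP_upper2[of 1]) (auto intro!: sum_nonneg)
  have "uniformly_integrable_seq x \<longleftrightarrow> (\<forall>e::real>0. \<forall>\<^sub>F c in at_top. G c \<le> ereal e)"
  proof
    assume "uniformly_integrable_seq x"
    then have lim: "(G \<longlongrightarrow> 0) at_top"
      by (simp add: uniformly_integrable_seq_def G_def[abs_def])
    show "\<forall>e::real>0. \<forall>\<^sub>F c in at_top. G c \<le> ereal e"
    proof (intro allI impI)
      fix e :: real assume "e > 0"
      then have "\<forall>\<^sub>F c in at_top. G c < ereal e"
        by (intro order_tendstoD(2)[OF lim]) auto
      then show "\<forall>\<^sub>F c in at_top. G c \<le> ereal e"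
        by eventually_elim simp
    qed
  next
    assume small: "\<forall>e::real>0. \<forall>\<^sub>F c in at_top. G c \<le> ereal e"
    have "(G \<longlongrightarrow> 0) at_top"
    proof (rule order_tendstoI)
      fix a :: ereal assume "a < 0"
      then show "\<forall>\<^sub>F c in at_top. a < G c"
        using G_nonneg by (intro always_eventually allI) (rule less_le_trans)
    next
      fix a :: ereal assume "0 < a"
      \<comment> \<open>A real \<open>e\<close> strictly below \<open>a\<close> covers the case of
        infinite \<open>a\<close> and turns the weak bound into a strict one.\<close>
      then obtain e :: real where "0 < ereal e" "ereal e < a"
        using ereal_dense2 by blast
      with small have "\<forall>\<^sub>F c in at_top. G c \<le> ereal e" by simp
      then show "\<forall>\<^sub>F c in at_top. G c < a"
        by eventually_elim (rule le_less_trans[OF _ \<open>ereal e < a\<close>])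
    qed
    then show "uniformly_integrable_seq x"
      by (simp add: uniformly_integrable_seq_def G_def[abs_def])
  qed
  then show ?thesis
    by (simp add: G_le eventually_at_top_linorder)
qed

text \<open>Markov's inequality for counting: each index in \<open>K n\<close> contributes more than
  \<open>\<epsilon>\<close> to \<open>S n\<close>, so \<open>card (K n)\<close> is at most
  \<open>S n / \<epsilon>\<close>; then \<open>f\<close> is applied to both sides.\<close>

lemma f_strong_Cesaro_imp_stat:
  assumes f: "modulus_function f" and conv: "f_strong_Cesaro_convergent f x L"
  shows "f_stat_convergent f x L"
  unfolding f_stat_convergent_def
proof (intro allI impI)
  fix \<epsilon> :: real assume \<epsilon>: "\<epsilon> > 0"
  define S where "S n = (\<Sum>k=1..n. \<bar>x k - L\<bar>)" for n
  define K where "K n = {k \<in> {1..n}. \<bar>x k - L\<bar> > \<epsilon>}" for n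
  obtain m :: nat where m: "1 / \<epsilon> \<le> real m" using real_arch_simple by blast
  have S_nonneg: "S n \<ge> 0" for n unfolding S_def by (simp add: sum_nonneg)
  have "real (card (K n)) \<le> real m * S n" for n
  proof -
    have "real (card (K n)) * \<epsilon> = (\<Sum>k\<in>K n. \<epsilon>)" by simp
    also have "\<dots> \<le> (\<Sum>k\<in>K n. \<bar>x k - L\<bar>)" by (rule sum_mono) (auto simp: K_def)
    also have "\<dots> \<le> S n" unfolding S_def by (rule sum_mono2) (auto simp: K_def)
    finally have "real (card (K n)) \<le> 1 / \<epsilon> * S n" using \<epsilon> by (simp add: field_simps)
    also have "\<dots> \<le> real m * S n" using m S_nonneg by (intro mult_right_mono)
    finally show ?thesis .
  qed
  then have le: "f (real (card (K n))) \<le> real m * f (S n)" for n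
    using S_nonneg by (intro modulus_function_le_mult[OF f]) auto
  have lim: "(\<lambda>n. real m * (f (S n) / f (real n))) \<longlonglongrightarrow> 0"
    using conv unfolding f_strong_Cesaro_convergent_def S_def[symmetric]
    by (rule tendsto_mult_right_zero)
  show "(\<lambda>n. 1 / f (real n) * f (real (card (K n)))) \<longlonglongrightarrow> 0"
  proof (rule tendsto_sandwich[OF _ _ tendsto_const lim])
    show "\<forall>\<^sub>F n in sequentially. 0 \<le> 1 / f (real n) * f (real (card (K n)))"
      using modulus_function_nonneg[OF f] by (intro always_eventually allI mult_nonneg_nonneg) auto
    show "\<forall>\<^sub>F n in sequentially.
            1 / f (real n) * f (real (card (K n))) \<le> real m * (f (S n) / f (real n))"
      \<comment> \<open>This holds for every \<open>n\<close>; at \<open>n = 0\<close> both sides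
        are 0 because division by \<open>f 0 = 0\<close> yields 0.\<close>
      using le modulus_function_nonneg[OF f]
      by (intro always_eventually allI) (simp add: divide_right_mono)
  qed
qed

lemma f_strong_Cesaro_imp_small_mean:
  assumes f: "modulus_function f" and conv: "f_strong_Cesaro_convergent f x L" and "e > 0"
  shows "\<forall>\<^sub>F n in sequentially. (\<Sum>k=1..n. \<bar>x k - L\<bar>) \<le> e * real n"
proof -
  define S where "S n = (\<Sum>k=1..n. \<bar>x k - L\<bar>)" for n
  have S_nonneg: "S n \<ge> 0" for n unfolding S_def by (simp add: sum_nonneg)
  obtain m :: nat where m: "1 / e < real m" using reals_Archimedean2 by blast
  have m_pos: "real m > 0" using m \<open>e > 0\<close> by (meson divide_pos_pos less_trans zero_less_one)
  \<comment> \<open>The threshold \<open>1 / m\<close> is what the contradiction needs: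
    \<open>S n > e * n\<close> would give \<open>f n \<le> m * f (S n)\<close>.\<close>
  have "\<forall>\<^sub>F n in sequentially. f (S n) / f (real n) < 1 / real m"
    using conv m_pos unfolding f_strong_Cesaro_convergent_def S_def[symmetric]
    by (intro order_tendstoD(2)) auto
  then have "\<forall>\<^sub>F n in sequentially. S n \<le> e * real n"
    using eventually_ge_at_top[of 1]
  proof eventually_elim
    case (elim n)
    have fn: "f (real n) > 0" using elim by (intro modulus_function_pos[OF f]) auto
    show ?case
    proof (rule ccontr)
      assume "\<not> S n \<le> e * real n"
      then have "real n \<le> 1 / e * S n" using \<open>e > 0\<close> by (simp add: field_simps)
      also have "\<dots> \<le> real m * S n" using m S_nonneg by (intro mult_right_mono) auto
      finally have "f (real n) \<le> real m * f (S n)"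
        using S_nonneg by (intro modulus_function_le_mult[OF f]) auto
      with elim(1) fn m_pos show False by (simp add: field_simps)
    qed
  qed
  then show ?thesis by (simp add: S_def)
qed

lemma f_strong_Cesaro_imp_uniformly_integrable:
  assumes f: "modulus_function f" and conv: "f_strong_Cesaro_convergent f x L"
  shows "uniformly_integrable_seq x"
  unfolding uniformly_integrable_seq_iff
proof (intro allI impI)
  fix e :: real assume e: "e > 0"
  then obtain N where N: "\<And>n. n \<ge> N \<Longrightarrow> (\<Sum>k=1..n. \<bar>x k - L\<bar>) \<le> e / 2 * real n"
    using f_strong_Cesaro_imp_small_mean[OF f conv, of "e / 2"]
    by (auto simp: eventually_sequentially)
  \<comment> \<open>The term \<open>2 * \<bar>L\<bar>\<close> serves \<open>n \<ge> N\<close>; the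
    sum plus 1 exceeds every \<open>\<bar>x k\<bar>\<close> with \<open>k \<le> N\<close>, which
    leaves no large terms when \<open>n < N\<close>.\<close>
  define C where "C = 2 * \<bar>L\<bar> + (\<Sum>k\<le>N. \<bar>x k\<bar>) + 1"
  have C_L: "C \<ge> 2 * \<bar>L\<bar>" unfolding C_def by (simp add: sum_nonneg)
  have C_x: "\<bar>x k\<bar> < C" if "k \<le> N" for k
  proof -
    have "\<bar>x k\<bar> \<le> (\<Sum>k\<le>N. \<bar>x k\<bar>)" using that by (intro member_le_sum) auto
    then show ?thesis by (simp add: C_def)
  qed
  show "\<exists>C. \<forall>c\<ge>C. \<forall>n\<ge>1. (\<Sum>k | k \<in> {1..n} \<and> c \<le> \<bar>x k\<bar>. \<bar>x k\<bar>) \<le> e * real n"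
  proof (intro exI allI impI)
    fix c n assume c: "C \<le> c"
    let ?B = "{k. k \<in> {1..n} \<and> c \<le> \<bar>x k\<bar>}"
    show "(\<Sum>k\<in>?B. \<bar>x k\<bar>) \<le> e * real n"
    proof (cases "n \<ge> N")
      case True
      have "(\<Sum>k\<in>?B. \<bar>x k\<bar>) \<le> (\<Sum>k\<in>?B. 2 * \<bar>x k - L\<bar>)"
      proof (rule sum_mono)
        fix k assume "k \<in> ?B"
        then have "2 * \<bar>L\<bar> \<le> \<bar>x k\<bar>" using c C_L by simp
        \<comment> \<open>By the triangle inequality, \<open>\<bar>x k\<bar> \<le> \<bar>x k -
          L\<bar> + \<bar>x k\<bar> / 2\<close>.\<close>
        then show "\<bar>x k\<bar> \<le> 2 * \<bar>x k - L\<bar>" by (smt (verit))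
      qed
      also have "\<dots> \<le> (\<Sum>k=1..n. 2 * \<bar>x k - L\<bar>)"
        by (rule sum_mono2) auto
      also have "\<dots> \<le> e * real n"
        using N[OF True] by (simp flip: sum_distrib_left)
      finally show ?thesis .
    next
      case False
      have "\<bar>x k\<bar> < c" if "k \<le> n" for k
        using that False c C_x[of k] by simp
      then have "?B = {}" by force
      then have "(\<Sum>k\<in>?B. \<bar>x k\<bar>) = 0" by (simp only: sum.empty)
      then show ?thesis using e by (simp only: mult_nonneg_nonneg less_imp_le of_nat_0_le_iff)
    qed
  qed
qed

lemma f_stat_imp_strong_Cesaro:
  assumes f: "modulus_function f" and "compatible f"
    and stat: "f_stat_convergent f x L" and ui: "uniformly_integrable_seq x"
  shows "f_strong_Cesaro_convergent f x L"
proof -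
  define S where "S n = (\<Sum>k=1..n. \<bar>x k - L\<bar>)" for n
  have S_nonneg: "S n \<ge> 0" for n unfolding S_def by (simp add: sum_nonneg)
  have "\<forall>\<^sub>F n in sequentially. f (S n) / f (real n) < \<delta>" if \<delta>: "\<delta> > 0" for \<delta>
  proof -
    \<comment> \<open>The budget \<open>\<delta>\<close> is halved: one half for
      \<open>f (n * \<eta>) / f n\<close>, the other for the statistical term.\<close>
    have "\<forall>\<^sub>F \<eta> in at_right 0.
            limsup (\<lambda>n. ereal (f (real n * \<eta>) / f (real n))) < ereal (\<delta> / 2)"
      using \<open>compatible f\<close> \<delta> unfolding compatible_def by (intro order_tendstoD(2)) auto
    then have "\<forall>\<^sub>F \<eta> in at_right (0::real). 0 < \<eta> \<and>
            limsup (\<lambda>n. ereal (f (real n * \<eta>) / f (real n))) < ereal (\<delta> / 2)"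
      by (intro eventually_conj eventually_at_right_less)
    then obtain \<eta> :: real where \<eta>: "\<eta> > 0"
      and "limsup (\<lambda>n. ereal (f (real n * \<eta>) / f (real n))) < ereal (\<delta> / 2)"
      using eventually_happens'[OF trivial_limit_at_right_real] by blast
    then have small: "\<forall>\<^sub>F n in sequentially. f (real n * \<eta>) / f (real n) < \<delta> / 2"
      by (auto dest!: Limsup_lessD)
    \<comment> \<open>One share of \<open>\<epsilon>\<close> pays for the indices outside
      \<open>K n\<close>, two for the terms with \<open>\<bar>x k\<bar> \<ge> c\<close>, whose
      deviation is at most \<open>2 * \<bar>x k\<bar>\<close>.\<close>
    define \<epsilon> where "\<epsilon> = \<eta> / 3"
    have \<epsilon>: "\<epsilon> > 0" using \<eta> by (simp add: \<epsilon>_def)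
    obtain C where C: "\<And>c n. c \<ge> C \<Longrightarrow> n \<ge> 1 \<Longrightarrow>
        (\<Sum>k | k \<in> {1..n} \<and> \<bar>x k\<bar> \<ge> c. \<bar>x k\<bar>) \<le> \<epsilon> * real n"
      using ui \<epsilon> unfolding uniformly_integrable_seq_iff by blast
    \<comment> \<open>Taking \<open>c \<ge> \<bar>L\<bar>\<close> ensures
      \<open>\<bar>x k - L\<bar> \<le> 2 * \<bar>x k\<bar>\<close> once
      \<open>\<bar>x k\<bar> \<ge> c\<close>; below \<open>c\<close> the deviation is at most the
      natural number \<open>M\<close> chosen next.\<close>
    define c where "c = max C \<bar>L\<bar>"
    obtain M :: nat where M: "c + \<bar>L\<bar> \<le> real M" using real_arch_simple by blast
    define K where "K n = {k \<in> {1..n}. \<bar>x k - L\<bar> > \<epsilon>}" for n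
    have S_le: "S n \<le> real n * \<eta> + real M * real (card (K n))" if n: "n \<ge> 1" for n
    proof -
      let ?B = "{k. k \<in> {1..n} \<and> \<bar>x k\<bar> \<ge> c}"
      \<comment> \<open>Three cases: \<open>k\<close> in \<open>?B\<close>, \<open>k\<close> in
        \<open>K n\<close> but not in \<open>?B\<close>, and \<open>k\<close> in neither. The sets
        may overlap, which only enlarges the right-hand side.\<close>
      have "\<bar>x k - L\<bar> \<le> \<epsilon> + (if k \<in> K n then real M else 0)
              + (if k \<in> ?B then 2 * \<bar>x k\<bar> else 0)" if "k \<in> {1..n}" for k
        using that M \<epsilon> by (auto simp: K_def c_def)
      then have "S n \<le> (\<Sum>k=1..n. \<epsilon> + (if k \<in> K n then real M else 0)
              + (if k \<in> ?B then 2 * \<bar>x k\<bar> else 0))"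
        unfolding S_def by (rule sum_mono)
      also have "\<dots> = real n * \<epsilon> + (\<Sum>k\<in>{1..n} \<inter> K n. real M)
                       + (\<Sum>k\<in>{1..n} \<inter> ?B. 2 * \<bar>x k\<bar>)"
        by (simp only: sum.distrib sum.inter_restrict finite_atLeastAtMost) simp
      also have "{1..n} \<inter> K n = K n" by (auto simp: K_def)
      also have "{1..n} \<inter> ?B = ?B" by auto
      also have "(\<Sum>k\<in>?B. 2 * \<bar>x k\<bar>) \<le> 2 * (\<epsilon> * real n)"
        using C[of c n] n by (simp add: c_def flip: sum_distrib_left)
      finally show ?thesis by (simp add: \<epsilon>_def algebra_simps)
    qed
    have "(\<lambda>n. real M * (1 / f (real n) * f (real (card (K n))))) \<longlonglongrightarrow> 0"
      using stat \<epsilon> unfolding f_stat_convergent_def K_def by (intro tendsto_mult_right_zero) auto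
    then have "\<forall>\<^sub>F n in sequentially.
        real M * (1 / f (real n) * f (real (card (K n)))) < \<delta> / 2"
      using \<delta> by (intro order_tendstoD(2)) auto
    then show ?thesis
      using small eventually_ge_at_top[of 1]
    proof eventually_elim
      case (elim n)
      have fn: "f (real n) > 0" using elim by (intro modulus_function_pos[OF f]) auto
      have "f (S n) \<le> f (real n * \<eta> + real M * real (card (K n)))"
        using S_le elim S_nonneg by (intro modulus_function_mono[OF f]) auto
      also have "\<dots> \<le> f (real n * \<eta>) + f (real M * real (card (K n)))"
        using \<eta> by (intro modulus_function_add[OF f]) auto
      also have "\<dots> \<le> f (real n * \<eta>) + real M * f (real (card (K n)))"
        by (intro add_left_mono modulus_function_mult[OF f]) auto
      finally have "f (S n) / f (real n) \<le>
          (f (real n * \<eta>) + real M * f (real (card (K n)))) / f (real n)"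
        using fn by (intro divide_right_mono) auto
      also have "\<dots> < \<delta>"
        using elim unfolding add_divide_distrib by simp argo
      finally show ?case .
    qed
  qed
  moreover have "f (S n) / f (real n) \<ge> 0" for n
    using modulus_function_nonneg[OF f] S_nonneg by simp
  ultimately have "(\<lambda>n. f (S n) / f (real n)) \<longlonglongrightarrow> 0"
    by (intro order_tendstoI) (auto intro: always_eventually less_le_trans)
  then show ?thesis by (simp add: f_strong_Cesaro_convergent_def S_def)
qed

theorem theorem2p9:
  fixes f :: "real \<Rightarrow> real"
    and As :: "nat \<Rightarrow> 'a::metric_space set"
    and A :: "'a set"
  assumes "unbounded_modulus f"
    and "\<And>k. k \<ge> 1 \<Longrightarrow> As k \<in> CL"
    and "A \<in> CL"
  shows "(Wijsman_f_strong_Cesaro_convergent f As A \<longrightarrow>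
            Wijsman_f_stat_convergent f As A \<and> Wijsman_uniformly_integrable As) \<and>
         (compatible f \<longrightarrow>
            Wijsman_f_stat_convergent f As A \<and> Wijsman_uniformly_integrable As \<longrightarrow>
            Wijsman_f_strong_Cesaro_convergent f As A)"
proof -
  have "modulus_function f" using assms(1) by (simp add: unbounded_modulus_def)
  \<comment> \<open>Each Wijsman notion is the real-sequence notion at every point \<open>x\<close>,
    so the lemmas apply pointwise with \<open>L = infdist x A\<close>.\<close>
  then show ?thesis
    unfolding Wijsman_f_strong_Cesaro_convergent_def Wijsman_f_stat_convergent_def
      Wijsman_uniformly_integrable_def
    by (blast intro: f_strong_Cesaro_imp_stat f_strong_Cesaro_imp_uniformly_integrable
        f_stat_imp_strong_Cesaro)
qed

end
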